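(* Let $\widehat f_r(x)=x^\top\widehat\alpha_r+\widehat g_r(x)$, where $$(\widehat\alpha_r,\widehat g_r)=\operatorname*{arg\,min}_{\alpha\in\mathbb R^d,\ g\in\mathcal H_K}\Big\{\frac1n\sum_{i=1}^n\big(Y_i-X_i^\top\alpha-g(X_i)\big)^2+\mu\|\alpha\|^2+\lambda\|g\|_K^2\Big\}$$ is computed from the fixed-design data described in the context. Assume $K$ is symmetric and positive semi-definite. Then for any $\mu,\lambda>0$, $$\mathcal R(\widehat f_r-f^* )\ \le\ \inf_{\alpha\in\mathbb R^d,\ f\in\mathcal H_K}\Big\{\mathcal R(\langle\alpha,\cdot\rangle+f-f^* )+\mu\|\alpha\|^2+\lambda\|f\|_K^2\Big\}+\frac{2\sigma^2}{n}\Big(\sum_{i=1}^d\Big(\frac{\widehat\tau_i}{\widehat\tau_i+\mu}\Big)^2+\sum_{i=1}^n\Big(\frac{\widetilde\nu_i}{\widetilde\nu_i+\lambda}\Big)^2\Big).$$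
   Context: Model and fixed design: $\mathcal X\subseteq\mathbb R^d$, the points $X_1,\dots,X_n\in\mathcal X$ are deterministic, $f^*:\mathcal X\to\mathbb R$ is the regression function, and $Y_i=f^*(X_i)+\epsilon_i$, where $\epsilon_1,\dots,\epsilon_n$ are independent with $\mathbb E[\epsilon_i]=0$ and $\mathbb E[\epsilon_i^2]=\sigma^2$. The design matrix is $\mathbb X=(X_1,\dots,X_n)^\top\in\mathbb R^{n\times d}$ (no rank assumption). Kernel: $K:\mathcal X\times\mathcal X\to\mathbb R$ is a kernel function; positive semi-definite means every matrix $(K(x_i,x_j))_{i,j}$ for finitely many points is positive semi-definite. $\mathcal H_K$ is the reproducing kernel Hilbert space of $K$, with norm $\|\cdot\|_K$. The kernel matrix $\mathbb K\in\mathbb R^{n\times n}$ has entries $\mathbb K_{ij}=n^{-1}K(X_i,X_j)$. Let $P_\mu=\mathbb X(\mathbb X^\top\mathbb X+n\mu\,\mathbb I_d)^{-1}\mathbb X^\top$ and $Q_\mu=\mathbb I_n-P_\mu$. The eigenvalues of $Q_\mu\mathbb KQ_\mu$ are $\widetilde\nu_1\ge\cdots\ge\widetilde\nu_n\ge0$, and the eigenvalues of $\widehat\Sigma=\frac1n\mathbb X^\top\mathbb X$ are $\widehat\tau_1\ge\cdots\ge\widehat\tau_d\ge0$. Risk: for a (possibly data-dependent) function $f:\mathcal X\to\mathbb R$, $\mathcal R(f-f^* )=\frac1n\sum_{i=1}^n\mathbb E[(f(X_i)-f^*(X_i))^2]$; the expectation is over the noise. $\langle\alpha,\cdot\rangle$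 denotes the linear function $x\mapsto x^\top\alpha$. *)

theory Defs
  imports "HOL-Probability.Probability" "HOL-Computational_Algebra.Polynomial"
begin

definition psd_kernel_on :: "'a set \<Rightarrow> ('a \<Rightarrow> 'a \<Rightarrow> real) \<Rightarrow> bool" where
  "psd_kernel_on X K \<longleftrightarrow>
     (\<forall>m (x :: nat \<Rightarrow> 'a) (c :: nat \<Rightarrow> real). (\<forall>i<m. x i \<in> X) \<longrightarrow>
        0 \<le> (\<Sum>i<m. \<Sum>j<m. c i * c j * K (x i) (x j)))"

definition rkhs_norm :: "(('a \<Rightarrow> real) \<Rightarrow> ('a \<Rightarrow> real) \<Rightarrow> real) \<Rightarrow> ('a \<Rightarrow> real) \<Rightarrow> real" where
  "rkhs_norm ip f = sqrt (ip f f)"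

(* (H, ip) is a Hilbert space of real functions on X with reproducing kernel K.
   A function on X is encoded as a total function that is 0 outside X, so that
   equality of functions is equality on X and the pointwise operations stay in
   the encoding. The values of K outside X play no role. By the Moore-Aronszajn
   theorem K determines (H, ip on H), and such a pair exists whenever K is
   symmetric and positive semi-definite on X. *)
locale rkhs =
  fixes X :: "'a set"
    and K :: "'a \<Rightarrow> 'a \<Rightarrow> real"
    and H :: "('a \<Rightarrow> real) set"
    and ip :: "('a \<Rightarrow> real) \<Rightarrow> ('a \<Rightarrow> real) \<Rightarrow> real"
  assumes zero_off: "\<lbrakk>f \<in> H; x \<notin> X\<rbrakk> \<Longrightarrow> f x = 0"
    and zero_mem: "(\<lambda>x. 0) \<in> H"
    and add_mem: "\<lbrakk>f \<in> H; g \<in> H\<rbrakk> \<Longrightarrow> (\<lambda>x. f x + g x) \<in> H"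
    and scale_mem: "f \<in> H \<Longrightarrow> (\<lambda>x. c * f x) \<in> H"
    and ip_sym: "\<lbrakk>f \<in> H; g \<in> H\<rbrakk> \<Longrightarrow> ip f g = ip g f"
    and ip_add: "\<lbrakk>f \<in> H; g \<in> H; h \<in> H\<rbrakk> \<Longrightarrow> ip (\<lambda>x. f x + g x) h = ip f h + ip g h"
    and ip_scale: "\<lbrakk>f \<in> H; h \<in> H\<rbrakk> \<Longrightarrow> ip (\<lambda>x. c * f x) h = c * ip f h"
    and ip_nonneg: "f \<in> H \<Longrightarrow> 0 \<le> ip f f"
    and ip_definite: "\<lbrakk>f \<in> H; ip f f = 0\<rbrakk> \<Longrightarrow> f = (\<lambda>x. 0)"
    and complete: "Metric_space.mcomplete H (\<lambda>f g. rkhs_norm ip (\<lambda>x. f x - g x))"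
    and section_mem: "x \<in> X \<Longrightarrow> (\<lambda>y. if y \<in> X then K y x else 0) \<in> H"
    and reproducing: "\<lbrakk>f \<in> H; x \<in> X\<rbrakk> \<Longrightarrow> ip f (\<lambda>y. if y \<in> X then K y x else 0) = f x"

(* Throughout, the rows of the design matrix D are the design points:
   X_i = D $ i, with n = CARD('n) points in dimension d = CARD('d). *)

definition kernel_matrix :: "('a \<Rightarrow> 'a \<Rightarrow> real) \<Rightarrow> 'a^'n \<Rightarrow> real^'n^'n" where
  "kernel_matrix K D = (\<chi> i j. K (D $ i) (D $ j) / real CARD('n))"

definition emp_cov :: "real^'d^'n \<Rightarrow> real^'d^'d" where
  "emp_cov D = (1 / real CARD('n)) *\<^sub>R (transpose D ** D)"

definition P_mat :: "real^'d^'n \<Rightarrow> real \<Rightarrow> real^'n^'n" where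
  "P_mat D \<mu> = D ** matrix_inv (transpose D ** D + mat (real CARD('n) * \<mu>)) ** transpose D"

definition Q_mat :: "real^'d^'n \<Rightarrow> real \<Rightarrow> real^'n^'n" where
  "Q_mat D \<mu> = mat 1 - P_mat D \<mu>"

definition charpoly :: "real^'n^'n \<Rightarrow> real poly" where
  "charpoly A = det (mat [:0, 1:] - map_matrix (\<lambda>a. [:a:]) A)"

(* e 1 \<ge> ... \<ge> e n are the eigenvalues of A, repeated by algebraic multiplicity. *)
definition eigenvalue_seq :: "real^'n^'n \<Rightarrow> (nat \<Rightarrow> real) \<Rightarrow> bool" where
  "eigenvalue_seq A e \<longleftrightarrow>
     charpoly A = (\<Prod>i=1..CARD('n). [:- e i, 1:]) \<and> antimono_on {1..CARD('n)} e"

definition objective ::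
  "real^'d^'n \<Rightarrow> ((real^'d \<Rightarrow> real) \<Rightarrow> (real^'d \<Rightarrow> real) \<Rightarrow> real) \<Rightarrow> real \<Rightarrow> real \<Rightarrow> real^'n
     \<Rightarrow> (real^'d) \<times> (real^'d \<Rightarrow> real) \<Rightarrow> real" where
  "objective D ip \<mu> lam Y = (\<lambda>(\<alpha>, g).
     (\<Sum>i\<in>UNIV. (Y $ i - (D $ i) \<bullet> \<alpha> - g (D $ i))\<^sup>2) / real CARD('n)
       + \<mu> * (norm \<alpha>)\<^sup>2 + lam * (rkhs_norm ip g)\<^sup>2)"

(* The minimiser is taken with the choice-based arg_min; for positive penalties
   it exists and is unique. *)
definition ridge_estimator ::
  "real^'d^'n \<Rightarrow> (real^'d \<Rightarrow> real) set \<Rightarrow> ((real^'d \<Rightarrow> real) \<Rightarrow> (real^'d \<Rightarrow> real) \<Rightarrow> real)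
     \<Rightarrow> real \<Rightarrow> real \<Rightarrow> real^'n \<Rightarrow> real^'d \<Rightarrow> real" where
  "ridge_estimator D H ip \<mu> lam Y x =
     (case arg_min (objective D ip \<mu> lam Y) (\<lambda>(\<alpha>, g). g \<in> H) of (\<alpha>, g) \<Rightarrow> x \<bullet> \<alpha> + g x)"

(* h may depend on the outcome w of the noise. *)
definition risk :: "'w measure \<Rightarrow> 'a^'n \<Rightarrow> ('w \<Rightarrow> 'a \<Rightarrow> real) \<Rightarrow> real" where
  "risk M D h = (\<Sum>i\<in>UNIV. (\<integral>w. (h w (D $ i))\<^sup>2 \<partial>M)) / real CARD('n)"

end

theory Submission
  imports Defs
begin

text \<open>
  Write $G$ for the kernel matrix, $B = I + D D^T / (n \mu)$ and $R = (B + G / \lambda)^{-1}$. The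
  representer theorem identifies the minimiser explicitly (\<open>ridge_objective_expansion\<close>): its values
  at the design points are $(I - R) Y$. Hence the risk is $|R f^*|^2 / n$, the squared bias,
  plus $\sigma^2 / n$ times the sum of the squared entries of the smoother $S = I - R$.

  For the bias, $R f^*$ is the residual of the fit to the noiseless data $f^*$. So $|R f^*|^2 / n$ is
  at most the minimal value of the objective at these data, and therefore at most its value at any
  $(\alpha, f)$, which is the bracket in the infimum.

  For the variance, decompose $S = P_\mu + (Q_\mu - R)$, where $Q_\mu = B^{-1}$. The sum of squares
  of a symmetric matrix is the trace of its square, so the two parts contribute at most
  $2 \, tr (P_\mu^2) + 2 \, tr ((Q_\mu - R)^2)$. The second part is not a function of
  $A = Q_\mu G Q_\mu$, but it satisfies $0 \le Q_\mu - R \le A (A + \lambda)^{-1}$ in the order of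
  positive semidefinite matrices (\<open>penalised_resolvent_comparison\<close>), and the trace of the square
  is monotone in that order (\<open>trace_square_mono\<close>, from Schur's product theorem).

  It remains to express $tr (V^2)$ by eigenvalues for $V = A (A + c)^{-1}$, where the eigenvalues are
  given as the roots of the characteristic polynomial. That polynomial determines $\det (1 - h V)$,
  hence $\det (1 - h^2 V^2) = \det (1 - h V) \det (1 + h V)$, and the trace of $V^2$ is the
  first-order coefficient of the latter in $-h^2$ (\<open>trace_square_resolvent\<close>).
\<close>

section \<open>Traces of squared resolvents and the characteristic polynomial\<close>

lemma matrix_mul_rdistribs:
  fixes A B :: "'a::ring_1^'m^'n" and C :: "'a^'p^'m"
  shows "(A + B) ** C = A ** C + B ** C" "(A - B) ** C = A ** C - B ** C"
  by (simp_all add: vec_eq_iff matrix_matrix_mult_def sum.distrib sum_subtractf algebra_simps)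

lemmas matrix_mul_scaleR = scalar_matrix_assoc[symmetric] matrix_scalar_ac

text \<open>
  In the Leibniz expansion every permutation other than the identity moves at least two
  points, so its product vanishes to second order at 0. Only the diagonal term survives.
\<close>

lemma DERIV_det_one_plus:
  fixes C :: "real^'n^'n"
  shows "((\<lambda>s. det (mat 1 + s *\<^sub>R C)) has_field_derivative trace C) (at 0)"
proof -
  let ?U = "UNIV :: 'n set"
  let ?e = "\<lambda>(p :: 'n \<Rightarrow> 'n) i s. (mat 1 :: real^'n^'n) $ i $ p i + s * C $ i $ p i"
  let ?d = "\<lambda>(p :: 'n \<Rightarrow> 'n). \<Sum>i\<in>?U. C $ i $ p i * (\<Prod>j\<in>?U - {i}. ?e p j 0)"
  have prod: "((\<lambda>s. \<Prod>i\<in>?U. ?e p i s) has_field_derivative ?d p) (at 0)" for p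
    by (rule has_field_derivative_prod) (auto intro!: derivative_eq_intros)
  have deriv: "((\<lambda>s. \<Sum>p | p permutes ?U. of_int (sign p) * (\<Prod>i\<in>?U. ?e p i s))
      has_field_derivative (\<Sum>p | p permutes ?U. of_int (sign p) * ?d p)) (at 0)"
    by (intro DERIV_sum DERIV_cmult prod)
  have "?d p = 0" if p: "p permutes ?U" and "p \<noteq> id" for p
  proof -
    obtain i where i: "p i \<noteq> i" using \<open>p \<noteq> id\<close> by (auto simp: fun_eq_iff)
    have pi: "p (p i) \<noteq> p i" using i permutes_inj[OF p] by (auto dest: injD)
    \<comment> \<open>\<open>i\<close> and \<open>p i\<close> are distinct points moved by \<open>p\<close>, and \<open>k\<close> removes at most one of them.\<close>
    have "(\<Prod>j\<in>?U - {k}. ?e p j 0) = 0" for k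
    proof (cases "k = i")
      case True
      then show ?thesis using pi i by (intro prod_zero bexI[of _ "p i"]) (auto simp: mat_def)
    next
      case False
      then show ?thesis using i by (intro prod_zero bexI[of _ i]) (auto simp: mat_def)
    qed
    then show ?thesis by (intro sum.neutral) (simp only: mult_zero_right, blast)
  qed
  then have "(\<Sum>p | p permutes ?U. of_int (sign p) * ?d p)
      = (\<Sum>p | p permutes ?U. if p = id then trace C else 0)"
    by (intro sum.cong) (auto simp: sign_id trace_def mat_def)
  also have "\<dots> = trace C"
    by (simp add: finite_permutations permutes_id)
  finally show ?thesis
    using deriv by (simp add: det_def)
qed

text \<open>
  The numbers \<open>b\<close> stand for the eigenvalues of \<open>V\<close>, encoded by the determinant alone: multiplying
  the hypothesis at \<open>h\<close> and \<open>- h\<close> gives the determinant of \<open>1 - h\<^sup>2 V\<^sup>2\<close>, and the first-order term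
  of both sides in \<open>s = - h\<^sup>2\<close> is the claim. As \<open>s\<close> only takes negative values, the derivatives at 0
  are compared from the left.
\<close>

lemma trace_square_eq_sum_squares:
  fixes V :: "real^'n^'n" and b :: "'i \<Rightarrow> real"
  assumes det: "\<And>h. \<bar>h\<bar> < 1 \<Longrightarrow> det (mat 1 - h *\<^sub>R V) = (\<Prod>i\<in>I. 1 - h * b i)"
  shows "trace (V ** V) = (\<Sum>i\<in>I. (b i)\<^sup>2)"
proof -
  have eq: "det (mat 1 + s *\<^sub>R (V ** V)) = (\<Prod>i\<in>I. 1 + s * (b i)\<^sup>2)" if s: "-1 < s" "s < 0" for s
  proof -
    define h where "h = sqrt (- s)"
    have h: "h * h = - s" "\<bar>h\<bar> < 1" using s by (auto simp: h_def)
    have "mat 1 + s *\<^sub>R (V ** V) = (mat 1 - h *\<^sub>R V) ** (mat 1 - (- h) *\<^sub>R V)"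
      using h(1)
      by (simp add: matrix_mul_rdistribs matrix_add_ldistrib matrix_mul_scaleR scaleR_diff_right)
    then have "det (mat 1 + s *\<^sub>R (V ** V)) = (\<Prod>i\<in>I. 1 - h * b i) * (\<Prod>i\<in>I. 1 - (- h) * b i)"
      using h(2) det[of h] det[of "- h"] by (simp add: det_mul)
    also have "\<dots> = (\<Prod>i\<in>I. 1 + s * (b i)\<^sup>2)"
    proof -
      have "s = - (h * h)" using h(1) by simp
      then show ?thesis
        by (simp add: prod.distrib[symmetric] algebra_simps power2_eq_square)
    qed
    finally show ?thesis .
  qed
  have "((\<lambda>s. det (mat 1 + s *\<^sub>R (V ** V))) has_field_derivative trace (V ** V)) (at_left 0)"
    using DERIV_det_one_plus by (rule has_field_derivative_at_within)
  moreover have "((\<lambda>s. \<Prod>i\<in>I. 1 + s * (b i)\<^sup>2) has_field_derivative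
      (\<Sum>i\<in>I. (b i)\<^sup>2 * (\<Prod>j\<in>I - {i}. 1 + 0 * (b j)\<^sup>2))) (at 0)"
    by (rule has_field_derivative_prod) (auto intro!: derivative_eq_intros)
  then have "((\<lambda>s. \<Prod>i\<in>I. 1 + s * (b i)\<^sup>2) has_field_derivative (\<Sum>i\<in>I. (b i)\<^sup>2)) (at_left 0)"
    by (simp add: has_field_derivative_at_within)
  then have "((\<lambda>s. det (mat 1 + s *\<^sub>R (V ** V))) has_field_derivative (\<Sum>i\<in>I. (b i)\<^sup>2)) (at_left 0)"
  proof (rule has_field_derivative_cong_eventually[THEN iffD2, rotated 2])
    show "\<forall>\<^sub>F s in at_left 0. det (mat 1 + s *\<^sub>R (V ** V)) = (\<Prod>i\<in>I. 1 + s * (b i)\<^sup>2)"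
      unfolding eventually_at_left_field using eq by (intro exI[of _ "-1"]) auto
  qed auto
  ultimately show ?thesis
    by (rule has_field_derivative_unique) (simp add: trivial_limit_at_left_real)
qed

lemma poly_charpoly: "poly (charpoly A) x = det (mat x - A)"
  for A :: "real^'n^'n"
proof -
  have "poly (of_int k) x = of_int k" for k by (metis of_int_poly poly_pCons mult_zero_right add.right_neutral poly_0)
  then show ?thesis
    unfolding charpoly_def det_def
    by (auto simp: poly_sum poly_prod mat_def intro!: sum.cong prod.cong)
qed

lemma det_scaleR: "det (c *\<^sub>R A) = c ^ CARD('n) * det A" for A :: "real^'n^'n"
  unfolding det_def
  by (simp add: prod.distrib sum_distrib_left mult_ac)

lemma det_add_mat_eigenvalue_seq:
  fixes A :: "real^'n^'n"
  assumes "eigenvalue_seq A e"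
  shows "det (A + mat t) = (\<Prod>i=1..CARD('n). e i + t)"
proof -
  have "A + mat t = (-1) *\<^sub>R (mat (- t) - A)"
    by (simp add: vec_eq_iff mat_def)
  then have "det (A + mat t) = (-1) ^ CARD('n) * poly (charpoly A) (- t)"
    by (simp only: det_scaleR poly_charpoly)
  also have "\<dots> = (-1) ^ CARD('n) * (\<Prod>i=1..CARD('n). (-1) * (e i + t))"
    using assms by (simp add: eigenvalue_seq_def poly_prod)
  also have "\<dots> = (\<Prod>i=1..CARD('n). e i + t)"
    by (simp only: prod.distrib prod_constant card_atLeastAtMost) (simp flip: power_mult_distrib mult.assoc)
  finally show ?thesis .
qed

text \<open>
  Here \<open>V = A (A + c)^{-1}\<close>, whose eigenvalues should be \<open>e i / (e i + c)\<close>. Indeed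
  \<open>(1 - h V) (A + c) = (1 - h) (A + c / (1 - h))\<close>, and the determinants of \<open>A + c\<close> and
  \<open>A + c / (1 - h)\<close> are values of the characteristic polynomial of \<open>A\<close>.
\<close>

lemma trace_square_resolvent:
  fixes A V :: "real^'n^'n"
  assumes e: "eigenvalue_seq A e" and inv: "det (A + mat c) \<noteq> 0"
    and V: "V ** (A + mat c) = A"
  shows "trace (V ** V) = (\<Sum>i=1..CARD('n). (e i / (e i + c))\<^sup>2)"
proof (rule trace_square_eq_sum_squares)
  fix h :: real
  assume "\<bar>h\<bar> < 1"
  then have h: "1 - h \<noteq> 0" by auto
  have nz: "e i + c \<noteq> 0" if "i \<in> {1..CARD('n)}" for i
    using inv that unfolding det_add_mat_eigenvalue_seq[OF e] by (auto simp: prod_zero_iff)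
  have "(mat 1 - h *\<^sub>R V) ** (A + mat c) = (1 - h) *\<^sub>R (A + mat (c / (1 - h)))"
  proof -
    have "(mat 1 - h *\<^sub>R V) ** (A + mat c) = (A + mat c) - h *\<^sub>R A"
      by (simp add: matrix_mul_rdistribs matrix_mul_scaleR V)
    also have "\<dots> = (1 - h) *\<^sub>R (A + mat (c / (1 - h)))"
      using h by (simp add: vec_eq_iff mat_def field_simps)
    finally show ?thesis .
  qed
  then have "det (mat 1 - h *\<^sub>R V) * det (A + mat c) = det ((1 - h) *\<^sub>R (A + mat (c / (1 - h))))"
    by (simp only: det_mul[symmetric])
  also have "\<dots> = (\<Prod>i=1..CARD('n). (1 - h) * (e i + c / (1 - h)))"
    by (simp only: det_scaleR det_add_mat_eigenvalue_seq[OF e] prod.distrib prod_constant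
        card_atLeastAtMost diff_Suc_1)
  also have "\<dots> = (\<Prod>i=1..CARD('n). (1 - h * (e i / (e i + c))) * (e i + c))"
    using h nz by (intro prod.cong) (auto simp: field_simps)
  finally show "det (mat 1 - h *\<^sub>R V) = (\<Prod>i=1..CARD('n). 1 - h * (e i / (e i + c)))"
    using inv det_add_mat_eigenvalue_seq[OF e] by (simp add: prod.distrib)
qed

section \<open>Positive semidefinite matrices\<close>

definition psd_matrix :: "real^'n^'n \<Rightarrow> bool" where
  "psd_matrix A \<longleftrightarrow> transpose A = A \<and> (\<forall>x. 0 \<le> x \<bullet> (A *v x))"

lemma psd_matrixD: "psd_matrix A \<Longrightarrow> transpose A = A" "psd_matrix A \<Longrightarrow> 0 \<le> x \<bullet> (A *v x)"
  by (auto simp: psd_matrix_def)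

lemma inner_matrix_vector_transpose: "x \<bullet> (A *v y) = (transpose A *v x) \<bullet> y"
  for A :: "real^'m^'n"
  by (simp add: dot_lmul_matrix)

lemma inner_symmetric_matrix: "transpose A = A \<Longrightarrow> x \<bullet> (A *v y) = (A *v x) \<bullet> y"
  for A :: "real^'n^'n"
  by (metis inner_matrix_vector_transpose)

lemma transpose_add: "transpose (A + B) = transpose A + transpose B"
  and transpose_diff: "transpose (A - B) = transpose A - transpose B"
  for A B :: "real^'m^'n"
  by (simp_all add: vec_eq_iff transpose_def)

lemma psd_matrix_add: "psd_matrix A \<Longrightarrow> psd_matrix B \<Longrightarrow> psd_matrix (A + B)"
  by (simp add: psd_matrix_def transpose_add matrix_vector_mult_add_rdistrib inner_add_right)

lemma psd_matrix_scaleR: "psd_matrix A \<Longrightarrow> 0 \<le> c \<Longrightarrow> psd_matrix (c *\<^sub>R A)"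
  by (simp add: psd_matrix_def transpose_scalar scaleR_matrix_vector_assoc[symmetric])

lemma psd_matrix_mat: "0 \<le> c \<Longrightarrow> psd_matrix (mat c :: real^'n^'n)"
proof -
  assume "0 \<le> c"
  moreover have "mat c *v x = c *\<^sub>R x" for x :: "real^'n"
    by (simp add: vec_eq_iff matrix_vector_mult_def mat_def if_distrib if_distribR cong: if_cong)
  ultimately show ?thesis by (simp add: psd_matrix_def)
qed

lemma psd_matrix_congruence:
  assumes "psd_matrix A"
  shows "psd_matrix (G ** A ** transpose G)"
proof -
  have "x \<bullet> ((G ** A ** transpose G) *v x) = (transpose G *v x) \<bullet> (A *v (transpose G *v x))" for x
    by (simp only: matrix_vector_mul_assoc[symmetric] inner_matrix_vector_transpose[of _ G])
  then show ?thesis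
    using assms by (simp add: psd_matrix_def matrix_transpose_mul matrix_mul_assoc)
qed

lemma psd_matrix_gram: "psd_matrix (G ** transpose G)"
  using psd_matrix_congruence[of "mat 1" G] by (simp add: psd_matrix_mat)

lemma psd_matrix_left_inverse:
  assumes A: "psd_matrix A" and R: "R ** A = mat 1"
  shows "psd_matrix R"
proof -
  have AR: "A ** R = mat 1" using R matrix_left_right_inverse by blast
  have "transpose R ** A = mat 1"
    using arg_cong[OF AR, of transpose] A by (simp add: matrix_transpose_mul psd_matrixD)
  then have "transpose R = R"
    using AR by (metis matrix_mul_assoc matrix_mul_lid matrix_mul_rid)
  moreover have "0 \<le> x \<bullet> (R *v x)" for x
  proof -
    have "A *v (R *v x) = x" by (simp add: matrix_vector_mul_assoc AR)
    then show ?thesis using psd_matrixD(2)[OF A, of "R *v x"] by (simp add: inner_commute)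
  qed
  ultimately show ?thesis by (simp add: psd_matrix_def)
qed

lemma psd_matrix_add_mat_invertible:
  assumes A: "psd_matrix A" and "0 < c"
  shows "invertible (A + mat c)"
proof -
  have "x = 0" if "(A + mat c) *v x = 0" for x
  proof -
    have "x \<bullet> (A *v x) + x \<bullet> (mat c *v x) = 0"
      using that by (simp add: matrix_vector_mult_add_rdistrib flip: inner_add_right)
    moreover have "mat c *v x = c *\<^sub>R x"
      by (simp add: vec_eq_iff matrix_vector_mult_def mat_def if_distrib if_distribR cong: if_cong)
    ultimately have "c * (x \<bullet> x) \<le> 0" using psd_matrixD(2)[OF A, of x] by simp
    then show "x = 0"
      using \<open>0 < c\<close> by (smt (verit) inner_gt_zero_iff mult_pos_pos)
  qed
  then show ?thesis
    by (simp add: invertible_left_inverse matrix_left_invertible_ker)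
qed

lemma matrix_inv_mult:
  fixes A :: "real^'n^'n"
  assumes "invertible A"
  shows "matrix_inv A ** A = mat 1" "A ** matrix_inv A = mat 1"
  using someI_ex[OF assms[unfolded invertible_def]] by (simp_all add: matrix_inv_def)

lemma quadratic_form_restrict:
  fixes m :: "'i \<Rightarrow> 'i \<Rightarrow> real"
  assumes "finite I" "J \<subseteq> I" "\<And>x. 0 \<le> (\<Sum>i\<in>I. \<Sum>j\<in>I. x i * x j * m i j)"
  shows "0 \<le> (\<Sum>i\<in>J. \<Sum>j\<in>J. x i * x j * m i j)"
proof -
  define y where "y i = (if i \<in> J then x i else 0)" for i
  have "(\<Sum>i\<in>J. \<Sum>j\<in>J. x i * x j * m i j) = (\<Sum>i\<in>I. \<Sum>j\<in>I. y i * y j * m i j)"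
    using assms(1,2) by (intro sum.mono_neutral_cong_left ballI sum.neutral) (auto simp: y_def)
  then show ?thesis using assms(3)[of y] by simp
qed

text \<open>
  This is Schur's product theorem tested on the all-ones vector. Induction on the index set
  performs one Cholesky step: splitting off the rank-one matrix built from row \<open>k\<close> of \<open>m\<close> leaves
  the Schur complement \<open>m'\<close>, which has zero row \<open>k\<close> and is again positive semidefinite. On the
  rank-one part the sum is a nonnegative multiple of a value of the quadratic form of \<open>n\<close>.
\<close>

lemma sum_entrywise_product_nonneg:
  fixes m n :: "'i \<Rightarrow> 'i \<Rightarrow> real"
  assumes "finite J" and "\<And>i j. m i j = m j i"
    and "\<And>x. 0 \<le> (\<Sum>i\<in>J. \<Sum>j\<in>J. x i * x j * m i j)"
    and "\<And>x. 0 \<le> (\<Sum>i\<in>J. \<Sum>j\<in>J. x i * x j * n i j)"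
  shows "0 \<le> (\<Sum>i\<in>J. \<Sum>j\<in>J. m i j * n i j)"
  using assms
proof (induction J arbitrary: m rule: finite_induct)
  case (insert k J)
  define q where "q = m k k"
  \<comment> \<open>If \<open>q = 0\<close> then row \<open>k\<close> vanishes, and \<open>x / 0 = 0\<close> makes the same formula give \<open>m\<close> itself.\<close>
  define m' where "m' i j = m i j - m k i * m k j / q" for i j
  define b where "b x = (\<Sum>j\<in>J. x j * m k j)" for x
  define a where "a x = (\<Sum>i\<in>J. \<Sum>j\<in>J. x i * x j * m i j)" for x
  have form: "0 \<le> t\<^sup>2 * q + 2 * t * b x + a x" for t x
  proof -
    let ?y = "x(k := t)"
    have y: "?y i = x i" if "i \<in> J" for i using that insert.hyps by auto
    have "(\<Sum>i\<in>insert k J. \<Sum>j\<in>insert k J. ?y i * ?y j * m i j)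
        = t * t * m k k + (\<Sum>j\<in>J. t * x j * m k j)
          + (\<Sum>i\<in>J. x i * t * m i k + (\<Sum>j\<in>J. x i * x j * m i j))"
      using insert.hyps y by (simp cong: sum.cong)
    also have "\<dots> = t\<^sup>2 * q + 2 * t * b x + a x"
    proof -
      have "(\<Sum>j\<in>J. t * x j * m k j) = t * b x"
        by (simp add: b_def sum_distrib_left mult_ac)
      moreover have "(\<Sum>i\<in>J. x i * t * m i k) = t * b x"
        unfolding b_def sum_distrib_left using insert.prems(1)
        by (intro sum.cong refl) (metis mult.assoc mult.commute)
      ultimately show ?thesis by (simp add: sum.distrib a_def q_def power2_eq_square)
    qed
    finally show ?thesis using insert.prems(2)[of ?y] by simp
  qed
  have a: "0 \<le> a x" for x using form[of 0 x] by simp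
  have q: "0 \<le> q" using form[of 1 "\<lambda>_. 0"] by (simp add: a_def b_def)
  have row0: "m k j = 0" if "q = 0" "j \<in> J" for j
  proof (rule ccontr)
    assume nz: "m k j \<noteq> 0"
    let ?x = "\<lambda>i. if i = j then 1 else 0 :: real"
    have "b ?x = m k j" using that insert.hyps by (simp add: b_def if_distrib if_distribR cong: if_cong)
    \<comment> \<open>With \<open>q = 0\<close> the form is affine in \<open>t\<close>; this \<open>t\<close> gives it the value -1.\<close>
    then show False using form[of "- (a ?x + 1) / (2 * m k j)" ?x] that nz by (simp add: field_simps)
  qed
  have m'_row: "m' k j = 0" if "j \<in> insert k J" for j
    using row0 that by (cases "q = 0") (auto simp: m'_def q_def)
  have m'_sym: "m' i j = m' j i" for i j
    using insert.prems(1) by (simp add: m'_def mult.commute)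
  have m'_psd: "0 \<le> (\<Sum>i\<in>J. \<Sum>j\<in>J. x i * x j * m' i j)" for x
  proof -
    have "(\<Sum>i\<in>J. \<Sum>j\<in>J. x i * x j * m' i j) = a x - (b x)\<^sup>2 / q"
      by (simp add: m'_def a_def b_def power2_eq_square sum_product sum_subtractf
          sum_divide_distrib algebra_simps)
    \<comment> \<open>Minimise the quadratic polynomial \<open>form\<close> over \<open>t\<close>.\<close>
    also have "0 \<le> a x - (b x)\<^sup>2 / q"
      using form[of "- b x / q" x] a[of x] q
      by (cases "q = 0") (simp_all add: power2_eq_square field_simps)
    finally show ?thesis .
  qed
  have "0 \<le> (\<Sum>i\<in>J. \<Sum>j\<in>J. m' i j * n i j)"
  proof (rule insert.IH[OF m'_sym m'_psd])
    show "0 \<le> (\<Sum>i\<in>J. \<Sum>j\<in>J. x i * x j * n i j)" for x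
      using insert.hyps(1) by (intro quadratic_form_restrict[OF _ _ insert.prems(3)]) auto
  qed
  also have "\<dots> = (\<Sum>i\<in>insert k J. \<Sum>j\<in>insert k J. m' i j * n i j)"
    using insert.hyps by (simp add: m'_row m'_sym[of _ k])
  finally have "0 \<le> (\<Sum>i\<in>insert k J. \<Sum>j\<in>insert k J. m' i j * n i j)" .
  moreover have "0 \<le> (\<Sum>i\<in>insert k J. \<Sum>j\<in>insert k J. m k i * m k j * n i j) / q"
    by (rule divide_nonneg_nonneg[OF insert.prems(3) q])
  moreover have "(\<Sum>i\<in>insert k J. \<Sum>j\<in>insert k J. m i j * n i j)
      = (\<Sum>i\<in>insert k J. \<Sum>j\<in>insert k J. m' i j * n i j)
        + (\<Sum>i\<in>insert k J. \<Sum>j\<in>insert k J. m k i * m k j * n i j) / q"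
    unfolding sum_divide_distrib sum.distrib[symmetric]
    by (intro sum.cong refl) (simp add: m'_def algebra_simps)
  ultimately show ?case by linarith
qed simp

lemma trace_mult_psd_nonneg:
  fixes A B :: "real^'n^'n"
  assumes "psd_matrix A" "psd_matrix B"
  shows "0 \<le> trace (A ** B)"
proof -
  have form: "(\<Sum>i\<in>UNIV. \<Sum>j\<in>UNIV. x i * x j * C $ i $ j) = (\<chi> i. x i) \<bullet> (C *v (\<chi> i. x i))"
    for C :: "real^'n^'n" and x
    by (simp add: inner_vec_def matrix_vector_mult_def sum_distrib_left mult_ac)
  have sym: "C $ i $ j = C $ j $ i" if "psd_matrix C" for C :: "real^'n^'n" and i j
    using psd_matrixD(1)[OF that] by (metis transpose_def vec_lambda_beta)
  have "0 \<le> (\<Sum>i\<in>UNIV. \<Sum>j\<in>UNIV. A $ i $ j * B $ i $ j)"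
    by (rule sum_entrywise_product_nonneg[OF finite sym[OF assms(1)]])
      (simp_all only: form psd_matrixD(2)[OF assms(1)] psd_matrixD(2)[OF assms(2)])
  also have "\<dots> = trace (A ** B)"
    unfolding trace_def matrix_matrix_mult_def vec_lambda_beta
    by (intro sum.cong refl) (simp only: sym[OF assms(2)])
  finally show ?thesis .
qed

text \<open>
  The difference of the two traces is \<open>tr ((B - A) (B + A))\<close>, a trace of a product of two
  positive semidefinite matrices.
\<close>

lemma trace_square_mono:
  assumes A: "psd_matrix A" and "psd_matrix (B - A)"
  shows "trace (A ** A) \<le> trace (B ** B)"
proof -
  have "psd_matrix B" using psd_matrix_add[OF assms] by simp
  then have "0 \<le> trace ((B - A) ** B) + trace ((B - A) ** A)"
    using assms by (intro add_nonneg_nonneg trace_mult_psd_nonneg)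
  also have "\<dots> = trace (B ** B) - trace (A ** A)"
    by (simp add: matrix_mul_rdistribs trace_sub trace_mul_sym[of A B])
  finally show ?thesis by simp
qed

lemma trace_square_symmetric:
  fixes A :: "real^'n^'n"
  assumes "transpose A = A"
  shows "trace (A ** A) = (\<Sum>i\<in>UNIV. \<Sum>j\<in>UNIV. (A $ i $ j)\<^sup>2)"
proof -
  have "A $ i $ j = A $ j $ i" for i j
    using assms by (metis transpose_def vec_lambda_beta)
  then show ?thesis
    unfolding trace_def matrix_matrix_mult_def power2_eq_square vec_lambda_beta
    by (intro sum.cong refl) metis
qed

text \<open>
  What the kernel adds to the linear smoother is \<open>Q - R\<close> with \<open>Q = B^{-1}\<close> and
  \<open>R = (B + K)^{-1}\<close>. It factors through \<open>Q^{1/2} K Q^{1/2}\<close>, whose eigenvalues are at least those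
  of \<open>Q K Q\<close>; nevertheless \<open>Q - R\<close> is dominated by the smoother \<open>1 - E\<close> of \<open>Q K Q\<close>. Both claims
  complete a square: with \<open>u = Q x\<close> and \<open>w = R x\<close>,
  \<open>x \<bullet> (Q - R) x = (w - u) \<bullet> B (w - u) + w \<bullet> K w\<close>, and with \<open>u = E x\<close>, \<open>z = Q u\<close> and \<open>P = 1 - Q\<close>,
  \<open>x \<bullet> ((1 - E) - (Q - R)) x = (x - u) \<bullet> P (x - u) + (w - z) \<bullet> (B + K) (w - z)\<close>.
\<close>

lemma penalised_resolvent_comparison:
  fixes Q B K R E :: "real^'n^'n"
  assumes P: "psd_matrix (mat 1 - Q)" and B: "psd_matrix B" and K: "psd_matrix K"
    and QB: "Q ** B = mat 1" and RBK: "R ** (B + K) = mat 1"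
    and E: "E ** (mat 1 + Q ** K ** Q) = mat 1"
  shows "psd_matrix (Q - R)" "psd_matrix ((mat 1 - E) - (Q - R))"
proof -
  have BK: "psd_matrix (B + K)" by (intro psd_matrix_add B K)
  have Q: "psd_matrix Q" by (rule psd_matrix_left_inverse[OF B QB])
  have QKQ: "psd_matrix (Q ** K ** Q)"
    using psd_matrix_congruence[OF K, of Q] by (simp add: psd_matrixD(1)[OF Q])
  have R: "psd_matrix R" by (rule psd_matrix_left_inverse[OF BK RBK])
  have Epsd: "psd_matrix E"
    by (rule psd_matrix_left_inverse[OF psd_matrix_add[OF psd_matrix_mat QKQ] E]) simp
  have inv: "B ** Q = mat 1" "(B + K) ** R = mat 1" "(mat 1 + Q ** K ** Q) ** E = mat 1"
    using QB RBK E matrix_left_right_inverse by blast+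
  note sym = psd_matrixD(1)[OF Q] psd_matrixD(1)[OF R] psd_matrixD(1)[OF Epsd]
  show "psd_matrix (Q - R)"
    unfolding psd_matrix_def
  proof (intro conjI allI)
    fix x
    define u w where "u = Q *v x" and "w = R *v x"
    have Bu: "B *v u = x" unfolding u_def by (simp add: matrix_vector_mul_assoc inv)
    have "(B + K) *v w = x" unfolding w_def by (simp only: matrix_vector_mul_assoc inv) simp
    then have Bw: "B *v w = x - K *v w" by (simp add: matrix_vector_mult_add_rdistrib eq_diff_eq)
    have "u \<bullet> (B *v w) = x \<bullet> w"
      by (simp only: inner_symmetric_matrix[OF psd_matrixD(1)[OF B]] Bu)
    then have "u \<bullet> (K *v w) = u \<bullet> x - x \<bullet> w" by (simp add: Bw inner_diff_right)
    then have "(w - u) \<bullet> (B *v (w - u)) = x \<bullet> u - x \<bullet> w - w \<bullet> (K *v w)"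
      by (simp add: matrix_vector_mult_diff_distrib Bu Bw inner_diff_left inner_diff_right inner_commute)
    then show "0 \<le> x \<bullet> ((Q - R) *v x)"
      using psd_matrixD(2)[OF B, of "w - u"] psd_matrixD(2)[OF K, of w]
      by (simp add: matrix_vector_mult_diff_rdistrib inner_diff_right flip: u_def w_def)
  qed (simp add: transpose_diff sym)
  show "psd_matrix ((mat 1 - E) - (Q - R))"
    unfolding psd_matrix_def
  proof (intro conjI allI)
    fix x
    define u w z where "u = E *v x" and "w = R *v x" and "z = Q *v u"
    have "(mat 1 + Q ** K ** Q) *v u = x" unfolding u_def by (simp only: matrix_vector_mul_assoc inv) simp
    then have QKz: "Q *v (K *v z) = x - u"
      by (simp add: z_def matrix_vector_mul_assoc matrix_mul_assoc matrix_vector_mult_add_rdistrib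
          eq_diff_eq add.commute)
    have BKw: "(B + K) *v w = x" unfolding w_def by (simp only: matrix_vector_mul_assoc inv) simp
    have Bz: "B *v z = u" unfolding z_def by (simp add: matrix_vector_mul_assoc inv)
    have zKz: "z \<bullet> (K *v z) = u \<bullet> x - u \<bullet> u"
    proof -
      have "z \<bullet> (K *v z) = u \<bullet> (Q *v (K *v z))"
        unfolding z_def by (simp only: inner_symmetric_matrix[OF sym(1), of u])
      then show ?thesis by (simp add: QKz inner_diff_right)
    qed
    have "(w - z) \<bullet> ((B + K) *v (w - z)) = w \<bullet> x - 2 * (z \<bullet> x) + z \<bullet> (B *v z) + z \<bullet> (K *v z)"
    proof -
      have "w \<bullet> ((B + K) *v z) = x \<bullet> z"
        by (simp only: inner_symmetric_matrix[OF psd_matrixD(1)[OF BK], of w] BKw)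
      moreover have "z \<bullet> ((B + K) *v z) = z \<bullet> (B *v z) + z \<bullet> (K *v z)"
        by (simp add: matrix_vector_mult_add_rdistrib inner_add_right)
      ultimately show ?thesis
        by (simp add: matrix_vector_mult_diff_distrib[of "B + K"] BKw inner_diff_left inner_diff_right
            inner_commute)
    qed
    moreover have "(x - u) \<bullet> ((mat 1 - Q) *v (x - u))
        = x \<bullet> x - 2 * (x \<bullet> u) + u \<bullet> u - x \<bullet> (Q *v x) + 2 * (x \<bullet> z) - u \<bullet> z"
    proof -
      have "u \<bullet> (Q *v x) = x \<bullet> z"
        unfolding z_def by (simp only: inner_symmetric_matrix[OF sym(1), of u] inner_commute)
      then show ?thesis
        by (simp add: matrix_vector_mult_diff_rdistrib matrix_vector_mult_diff_distrib
            inner_diff_left inner_diff_right inner_commute flip: z_def)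
    qed
    ultimately show "0 \<le> x \<bullet> (((mat 1 - E) - (Q - R)) *v x)"
      using psd_matrixD(2)[OF BK, of "w - z"] psd_matrixD(2)[OF P, of "x - u"]
      by (simp add: matrix_vector_mult_diff_rdistrib inner_diff_right Bz zKz inner_commute
          flip: u_def w_def)
  qed (simp add: transpose_diff sym)
qed

section \<open>Sum of squares of the ridge smoother\<close>

definition ridge_precision :: "real^'d^'n \<Rightarrow> real^'n^'n \<Rightarrow> real \<Rightarrow> real \<Rightarrow> real^'n^'n" where
  "ridge_precision D G \<mu> lam =
     mat 1 + (1 / (real CARD('n) * \<mu>)) *\<^sub>R (D ** transpose D) + (1 / lam) *\<^sub>R G"

text \<open>
  The ridge estimator fits \<open>y\<close> by \<open>y - R y\<close>, where \<open>R\<close> is this matrix. Its inverse shows that the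
  joint fit is kernel ridge regression for the sum of the linear kernel, scaled by \<open>1 / \<mu>\<close>, and the
  kernel with matrix \<open>G\<close>, scaled by \<open>1 / lam\<close>.
\<close>

definition residual_mat :: "real^'d^'n \<Rightarrow> real^'n^'n \<Rightarrow> real \<Rightarrow> real \<Rightarrow> real^'n^'n" where
  "residual_mat D G \<mu> lam = matrix_inv (ridge_precision D G \<mu> lam)"

lemma residual_mat_inverse:
  fixes D :: "real^'d^'n"
  assumes "psd_matrix G" "0 < \<mu>" "0 < lam"
  shows "residual_mat D G \<mu> lam ** ridge_precision D G \<mu> lam = mat 1"
    "ridge_precision D G \<mu> lam ** residual_mat D G \<mu> lam = mat 1"
proof -
  define A where "A = (1 / (real CARD('n) * \<mu>)) *\<^sub>R (D ** transpose D) + (1 / lam) *\<^sub>R G"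
  have "psd_matrix A"
    unfolding A_def using assms by (intro psd_matrix_add psd_matrix_scaleR psd_matrix_gram) auto
  then have "invertible (A + mat 1)"
    by (rule psd_matrix_add_mat_invertible) simp
  also have "A + mat 1 = ridge_precision D G \<mu> lam"
    by (simp add: A_def ridge_precision_def add_ac)
  finally have "invertible (ridge_precision D G \<mu> lam)" .
  then show "residual_mat D G \<mu> lam ** ridge_precision D G \<mu> lam = mat 1"
    "ridge_precision D G \<mu> lam ** residual_mat D G \<mu> lam = mat 1"
    unfolding residual_mat_def by (rule matrix_inv_mult)+
qed

lemma mat_scaleR: "(mat c :: real^'n^'n) = c *\<^sub>R mat 1"
  by (simp add: vec_eq_iff mat_def)

text \<open>
  \<open>P_mat D \<mu>\<close> is the smoother of ridge regression on the linear part alone, so its complement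
  inverts \<open>B\<close> (the push-through identity). Cyclicity of the trace moves the square of
  the n-by-n matrix \<open>P_mat D \<mu>\<close> to that of the d-by-d matrix \<open>\<Sigma> (\<Sigma> + \<mu>)^{-1}\<close>, where \<open>\<Sigma> = emp_cov D\<close>.
\<close>

lemma linear_smoother_facts:
  fixes D :: "real^'d^'n"
  assumes "0 < \<mu>"
  defines "B \<equiv> mat 1 + (1 / (real CARD('n) * \<mu>)) *\<^sub>R (D ** transpose D)"
  shows "psd_matrix B" "Q_mat D \<mu> ** B = mat 1" "psd_matrix (P_mat D \<mu>)"
    and "eigenvalue_seq (emp_cov D) \<tau> \<Longrightarrow>
      trace (P_mat D \<mu> ** P_mat D \<mu>) = (\<Sum>i=1..CARD('d). (\<tau> i / (\<tau> i + \<mu>))\<^sup>2)"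
proof -
  define c where "c = real CARD('n) * \<mu>"
  define N where "N = transpose D ** D + mat c"
  define J where "J = matrix_inv N"
  have c: "0 < c" using assms by (simp add: c_def)
  have gram: "psd_matrix (transpose D ** D)"
    using psd_matrix_gram[of "transpose D"] by simp
  have N: "psd_matrix N" unfolding N_def using c by (intro psd_matrix_add gram psd_matrix_mat) auto
  have invN: "invertible N" unfolding N_def by (rule psd_matrix_add_mat_invertible[OF gram c])
  then have JN: "J ** N = mat 1" unfolding J_def by (rule matrix_inv_mult)
  have P: "P_mat D \<mu> = D ** J ** transpose D" by (simp add: P_mat_def J_def N_def c_def)
  show "psd_matrix B" unfolding B_def using assms
    by (intro psd_matrix_add psd_matrix_scaleR psd_matrix_gram psd_matrix_mat) auto
  show "psd_matrix (P_mat D \<mu>)"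
    unfolding P by (intro psd_matrix_congruence psd_matrix_left_inverse[OF N JN])
  have "P_mat D \<mu> ** B = (1 / c) *\<^sub>R (D ** (J ** N) ** transpose D)"
  proof -
    have "c *\<^sub>R (P_mat D \<mu> ** B) = D ** J ** (c *\<^sub>R transpose D + transpose D ** D ** transpose D)"
      using c by (simp add: P B_def matrix_add_ldistrib matrix_mul_scaleR scaleR_add_right
          matrix_mul_assoc flip: c_def)
    also have "c *\<^sub>R transpose D + transpose D ** D ** transpose D = N ** transpose D"
      by (simp add: N_def mat_scaleR[of c] matrix_mul_rdistribs matrix_mul_scaleR)
    finally have "(1 / c) *\<^sub>R (c *\<^sub>R (P_mat D \<mu> ** B)) = (1 / c) *\<^sub>R (D ** (J ** N) ** transpose D)"
      by (simp add: matrix_mul_assoc)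
    then show ?thesis using c by simp
  qed
  then show "Q_mat D \<mu> ** B = mat 1"
    by (simp add: Q_mat_def matrix_mul_rdistribs JN B_def c_def)
  show "trace (P_mat D \<mu> ** P_mat D \<mu>) = (\<Sum>i=1..CARD('d). (\<tau> i / (\<tau> i + \<mu>))\<^sup>2)"
    if \<tau>: "eigenvalue_seq (emp_cov D) \<tau>"
  proof -
    let ?V = "transpose D ** D ** J"
    have "trace (P_mat D \<mu> ** P_mat D \<mu>) = trace (D ** (J ** transpose D ** D ** J ** transpose D))"
      by (simp add: P matrix_mul_assoc)
    also have "\<dots> = trace (J ** (transpose D ** D ** J ** transpose D ** D))"
      by (subst trace_mul_sym) (simp add: matrix_mul_assoc)
    also have "\<dots> = trace (?V ** ?V)"
      by (subst trace_mul_sym) (simp add: matrix_mul_assoc)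
    also have "\<dots> = (\<Sum>i=1..CARD('d). (\<tau> i / (\<tau> i + \<mu>))\<^sup>2)"
    proof (rule trace_square_resolvent[OF \<tau>])
      have eq: "emp_cov D + mat \<mu> = (1 / real CARD('n)) *\<^sub>R N"
        by (simp add: emp_cov_def N_def c_def vec_eq_iff mat_def field_simps)
      show "det (emp_cov D + mat \<mu>) \<noteq> 0"
        using invN by (simp add: eq det_scaleR invertible_det_nz)
      have "?V ** N = transpose D ** D"
        using JN by (simp add: matrix_mul_assoc[symmetric])
      then show "?V ** (emp_cov D + mat \<mu>) = emp_cov D"
        unfolding eq matrix_mul_scaleR by (simp add: emp_cov_def)
    qed
    finally show ?thesis .
  qed
qed

text \<open>
  The full smoother is the sum of the linear smoother \<open>P\<close> and of \<open>Q - R\<close>. The inequality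
  \<open>(p + w)\<^sup>2 \<le> 2 p\<^sup>2 + 2 w\<^sup>2\<close>, entry by entry, is where the factor 2 comes from. The first
  square gives the sum over \<open>\<tau>\<close>; for the second, \<open>Q - R\<close> is replaced by the larger smoother of
  \<open>Q G Q\<close>.
\<close>

lemma smoother_sum_squares_le:
  fixes D :: "real^'d^'n"
  assumes G: "psd_matrix G" and "0 < \<mu>" "0 < lam"
    and \<tau>: "eigenvalue_seq (emp_cov D) \<tau>"
    and \<nu>: "eigenvalue_seq (Q_mat D \<mu> ** G ** Q_mat D \<mu>) \<nu>"
  shows "(\<Sum>i\<in>UNIV. \<Sum>j\<in>UNIV. ((mat 1 - residual_mat D G \<mu> lam) $ i $ j)\<^sup>2)
    \<le> 2 * ((\<Sum>i=1..CARD('d). (\<tau> i / (\<tau> i + \<mu>))\<^sup>2)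
            + (\<Sum>i=1..CARD('n). (\<nu> i / (\<nu> i + lam))\<^sup>2))"
proof -
  define Q where "Q = Q_mat D \<mu>"
  define R where "R = residual_mat D G \<mu> lam"
  define B where "B = mat 1 + (1 / (real CARD('n) * \<mu>)) *\<^sub>R (D ** transpose D)"
  define A where "A = Q ** G ** Q"
  define E where "E = matrix_inv (mat 1 + (1 / lam) *\<^sub>R A)"
  note facts = linear_smoother_facts[OF \<open>0 < \<mu>\<close>, of D, folded B_def Q_def]
  have P: "P_mat D \<mu> = mat 1 - Q" by (simp add: Q_def Q_mat_def)
  have Q: "psd_matrix Q" by (rule psd_matrix_left_inverse[OF facts(1,2)])
  have A: "psd_matrix A"
    using psd_matrix_congruence[OF G, of Q] by (simp add: A_def psd_matrixD(1)[OF Q])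
  have K: "psd_matrix ((1 / lam) *\<^sub>R G)" using G \<open>0 < lam\<close> by (intro psd_matrix_scaleR) auto
  have QKQ: "Q ** ((1 / lam) *\<^sub>R G) ** Q = (1 / lam) *\<^sub>R A"
    by (simp add: A_def matrix_mul_scaleR)
  have "psd_matrix ((1 / lam) *\<^sub>R A)" using A \<open>0 < lam\<close> by (intro psd_matrix_scaleR) auto
  then have "invertible (mat 1 + (1 / lam) *\<^sub>R A)"
    using psd_matrix_add_mat_invertible[OF _ zero_less_one] by (metis add.commute)
  then have E: "E ** (mat 1 + (1 / lam) *\<^sub>R A) = mat 1"
    unfolding E_def by (rule matrix_inv_mult)
  have RB: "R ** (B + (1 / lam) *\<^sub>R G) = mat 1"
    using residual_mat_inverse(1)[OF G \<open>0 < \<mu>\<close> \<open>0 < lam\<close>, of D]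
    by (simp add: R_def ridge_precision_def B_def)
  have W: "psd_matrix (Q - R)" "psd_matrix ((mat 1 - E) - (Q - R))"
    using penalised_resolvent_comparison[OF _ facts(1) K facts(2) RB, of E] facts(3) E
    by (simp_all add: P QKQ)
  have "trace ((Q - R) ** (Q - R)) \<le> trace ((mat 1 - E) ** (mat 1 - E))"
    by (rule trace_square_mono[OF W])
  also have "\<dots> = (\<Sum>i=1..CARD('n). (\<nu> i / (\<nu> i + lam))\<^sup>2)"
  proof (rule trace_square_resolvent)
    show "eigenvalue_seq A \<nu>" using \<nu> by (simp add: A_def Q_def)
    show "det (A + mat lam) \<noteq> 0"
      using psd_matrix_add_mat_invertible[OF A \<open>0 < lam\<close>] by (simp add: invertible_det_nz)
    have eq: "A + mat lam = lam *\<^sub>R (mat 1 + (1 / lam) *\<^sub>R A)"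
      using \<open>0 < lam\<close> by (simp add: mat_scaleR[of lam] scaleR_add_right add.commute)
    have "E ** (A + mat lam) = mat lam"
      unfolding eq by (simp add: matrix_mul_scaleR E mat_scaleR[of lam])
    then show "(mat 1 - E) ** (A + mat lam) = A"
      by (simp add: matrix_mul_rdistribs)
  qed
  finally have trW: "trace ((Q - R) ** (Q - R)) \<le> (\<Sum>i=1..CARD('n). (\<nu> i / (\<nu> i + lam))\<^sup>2)" .
  have "(\<Sum>i\<in>UNIV. \<Sum>j\<in>UNIV. ((mat 1 - R) $ i $ j)\<^sup>2)
      \<le> (\<Sum>i\<in>UNIV. \<Sum>j\<in>UNIV. 2 * ((mat 1 - Q) $ i $ j)\<^sup>2 + 2 * ((Q - R) $ i $ j)\<^sup>2)"
  proof (intro sum_mono)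
    have "(p + w)\<^sup>2 \<le> 2 * p\<^sup>2 + 2 * w\<^sup>2" for p w :: real
      using zero_le_power2[of "p - w"] by (simp add: power2_sum power2_diff)
    note sq = this
    fix i j
    have "(mat 1 - R) $ i $ j = (mat 1 - Q) $ i $ j + (Q - R) $ i $ j" by simp
    then show "((mat 1 - R) $ i $ j)\<^sup>2 \<le> 2 * ((mat 1 - Q) $ i $ j)\<^sup>2 + 2 * ((Q - R) $ i $ j)\<^sup>2"
      by (simp only: sq)
  qed
  also have "\<dots> = 2 * trace ((mat 1 - Q) ** (mat 1 - Q)) + 2 * trace ((Q - R) ** (Q - R))"
    using psd_matrixD(1)[OF W(1)] psd_matrixD(1)[OF facts(3)]
    by (simp add: trace_square_symmetric P sum.distrib sum_distrib_left)
  also have "\<dots> \<le> 2 * ((\<Sum>i=1..CARD('d). (\<tau> i / (\<tau> i + \<mu>))\<^sup>2)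
            + (\<Sum>i=1..CARD('n). (\<nu> i / (\<nu> i + lam))\<^sup>2))"
    using trW facts(4)[OF \<tau>] by (simp add: P)
  finally show ?thesis by (simp add: R_def)
qed

section \<open>The minimiser of the penalised objective\<close>

context rkhs
begin

definition section_at :: "'a \<Rightarrow> 'a \<Rightarrow> real" where
  "section_at x = (\<lambda>y. if y \<in> X then K y x else 0)"

lemma section_at_mem: "x \<in> X \<Longrightarrow> section_at x \<in> H"
  unfolding section_at_def by (rule section_mem)

text \<open>
  Membership and the reproducing identity are proved together because the inner product of \<open>rkhs\<close>
  is only linear on \<open>H\<close>, so the inductive step for the identity needs the membership of the
  partial sum.
\<close>

lemma section_expansion:
  assumes "finite J" "\<And>j. j \<in> J \<Longrightarrow> z j \<in> X"
  shows "(\<lambda>x. \<Sum>j\<in>J. c j * section_at (z j) x) \<in> H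
    \<and> (\<forall>f\<in>H. ip (\<lambda>x. \<Sum>j\<in>J. c j * section_at (z j) x) f = (\<Sum>j\<in>J. c j * f (z j)))"
  using assms
proof (induction J rule: finite_induct)
  case empty
  have "ip (\<lambda>x. 0) f = 0" if "f \<in> H" for f
    using ip_scale[OF zero_mem that, of 0] by simp
  then show ?case using zero_mem by simp
next
  case (insert k J)
  let ?s = "\<lambda>x. c k * section_at (z k) x"
  let ?g = "\<lambda>x. \<Sum>j\<in>J. c j * section_at (z j) x"
  have k: "section_at (z k) \<in> H" using insert.prems by (intro section_at_mem) auto
  have s: "?s \<in> H" using k by (rule scale_mem)
  have g: "?g \<in> H" "\<And>f. f \<in> H \<Longrightarrow> ip ?g f = (\<Sum>j\<in>J. c j * f (z j))"
    using insert.IH insert.prems by auto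
  have sip: "ip ?s f = c k * f (z k)" if "f \<in> H" for f
    using that k insert.prems[of k] reproducing[OF that, of "z k"]
    by (simp add: ip_scale ip_sym[OF k that] flip: section_at_def)
  have eq: "(\<lambda>x. \<Sum>j\<in>insert k J. c j * section_at (z j) x) = (\<lambda>x. ?s x + ?g x)"
    using insert.hyps by auto
  show ?case
    unfolding eq using insert.hyps s g sip add_mem[OF s g(1)] by (auto simp: ip_add)
qed

lemma diff_mem: "f \<in> H \<Longrightarrow> g \<in> H \<Longrightarrow> (\<lambda>x. f x - g x) \<in> H"
  using add_mem[OF _ scale_mem[of g "-1"], of f] by simp

lemma rkhs_norm_square_add:
  assumes "f \<in> H" "g \<in> H"
  shows "(rkhs_norm ip (\<lambda>x. f x + g x))\<^sup>2 = ip f f + 2 * ip f g + ip g g"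
  using assms add_mem[OF assms] ip_nonneg[OF add_mem[OF assms]]
  by (simp add: rkhs_norm_def ip_add ip_sym[of f "\<lambda>x. f x + g x"] ip_sym[of g "\<lambda>x. f x + g x"]
      ip_sym[of g f])

lemma rkhs_norm_square: "f \<in> H \<Longrightarrow> (rkhs_norm ip f)\<^sup>2 = ip f f"
  by (simp add: rkhs_norm_def ip_nonneg)

end

lemma psd_matrix_kernel_matrix:
  fixes D :: "'a^'n"
  assumes D: "\<And>i. D $ i \<in> X" and sym: "\<And>x y. x \<in> X \<Longrightarrow> y \<in> X \<Longrightarrow> K x y = K y x"
    and K: "psd_kernel_on X K"
  shows "psd_matrix (kernel_matrix K D)"
proof -
  obtain f :: "nat \<Rightarrow> 'n" where f: "bij_betw f {..<CARD('n)} UNIV"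
    using ex_bij_betw_nat_finite[OF finite] by (auto simp: atLeast0LessThan)
  have "0 \<le> x \<bullet> (kernel_matrix K D *v x)" for x
  proof -
    let ?m = "CARD('n)"
    have "0 \<le> (\<Sum>i<?m. \<Sum>j<?m. x $ f i * x $ f j * K (D $ f i) (D $ f j))"
      using K[unfolded psd_kernel_on_def, rule_format, of ?m "\<lambda>i. D $ f i" "\<lambda>i. x $ f i"] D by simp
    also have "\<dots> = (\<Sum>i\<in>UNIV. \<Sum>j\<in>UNIV. x $ i * x $ j * K (D $ i) (D $ j))"
    proof -
      have reindex: "(\<Sum>i<?m. h (f i)) = (\<Sum>i\<in>UNIV. h i)" for h :: "'n \<Rightarrow> real"
        by (rule sum.reindex_bij_betw[OF f])
      have "(\<Sum>j<?m. x $ f i * x $ f j * K (D $ f i) (D $ f j))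
          = (\<Sum>j\<in>UNIV. x $ f i * x $ j * K (D $ f i) (D $ j))" for i
        by (rule reindex[of "\<lambda>j. x $ f i * x $ j * K (D $ f i) (D $ j)"])
      then show ?thesis
        by (simp only: reindex[of "\<lambda>i. \<Sum>j\<in>UNIV. x $ i * x $ j * K (D $ i) (D $ j)"])
    qed
    finally have "0 \<le> (\<Sum>i\<in>UNIV. \<Sum>j\<in>UNIV. x $ i * x $ j * K (D $ i) (D $ j)) / ?m"
      by simp
    also have "\<dots> = x \<bullet> (kernel_matrix K D *v x)"
      by (simp add: inner_vec_def matrix_vector_mult_def kernel_matrix_def sum_distrib_left
          sum_divide_distrib mult_ac)
    finally show ?thesis .
  qed
  moreover have "transpose (kernel_matrix K D) = kernel_matrix K D"
    using D sym by (simp add: transpose_def kernel_matrix_def vec_eq_iff)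
  ultimately show ?thesis by (simp add: psd_matrix_def)
qed

text \<open>
  The representer theorem in explicit form. The vector \<open>\<beta>\<close> is the residual of the fit \<open>(\<alpha>, g)\<close>
  with \<open>\<alpha> = D\<^sup>T \<beta> / (n \<mu>)\<close> and \<open>g = (\<Sum>j. \<beta>\<^sub>j K(\<cdot>, X\<^sub>j)) / (n lam)\<close>. These choices make the
  first-order terms of the objective around \<open>(\<alpha>, g)\<close> cancel, so what remains of the difference is
  the quadratic part. Thus \<open>(\<alpha>, g)\<close> is the minimiser, and it is the only one since the
  quadratic part is definite.
\<close>

lemma ridge_objective_expansion:
  fixes D :: "real^'d^'n" and \<beta> y :: "real^'n"
  assumes rk: "rkhs X K H ip" and D: "\<And>i. D $ i \<in> X" and "0 < \<mu>" "0 < lam"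
    and \<beta>: "\<beta> + (1 / (real CARD('n) * \<mu>)) *\<^sub>R (D *v (transpose D *v \<beta>))
               + (1 / lam) *\<^sub>R (kernel_matrix K D *v \<beta>) = y"
  obtains \<alpha> g where "g \<in> H" "\<And>i. D $ i \<bullet> \<alpha> + g (D $ i) = y $ i - \<beta> $ i"
    "\<And>\<alpha>' g'. g' \<in> H \<Longrightarrow> objective D ip \<mu> lam y (\<alpha>', g') = objective D ip \<mu> lam y (\<alpha>, g)
        + (\<Sum>i\<in>UNIV. (D $ i \<bullet> (\<alpha>' - \<alpha>) + (g' (D $ i) - g (D $ i)))\<^sup>2) / real CARD('n)
        + \<mu> * (norm (\<alpha>' - \<alpha>))\<^sup>2 + lam * ip (\<lambda>x. g' x - g x) (\<lambda>x. g' x - g x)"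
proof -
  interpret rkhs X K H ip by (rule rk)
  let ?n = "real CARD('n)"
  have n: "0 < ?n" by simp
  define \<alpha> where "\<alpha> = (1 / (?n * \<mu>)) *\<^sub>R (transpose D *v \<beta>)"
  define g where "g = (\<lambda>x. \<Sum>j\<in>UNIV. \<beta> $ j / (?n * lam) * section_at (D $ j) x)"
  have g: "g \<in> H" "\<And>f. f \<in> H \<Longrightarrow> ip g f = (\<Sum>j\<in>UNIV. \<beta> $ j / (?n * lam) * f (D $ j))"
    using section_expansion[of UNIV "\<lambda>j. D $ j" "\<lambda>j. \<beta> $ j / (?n * lam)", OF finite D, folded g_def] by blast+
  have Dv: "(D *v v) $ i = D $ i \<bullet> v" for v :: "real^'d" and i
    by (rule matrix_vector_mul_component)
  have gD: "g (D $ i) = (1 / lam) * (kernel_matrix K D *v \<beta>) $ i" for i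
    unfolding g_def section_at_def matrix_vector_mult_def kernel_matrix_def vec_lambda_beta
      sum_distrib_left
    using D by (intro sum.cong refl) (simp add: mult.commute)
  have fit: "D $ i \<bullet> \<alpha> + g (D $ i) = y $ i - \<beta> $ i" for i
  proof -
    have "D $ i \<bullet> \<alpha> = (1 / (?n * \<mu>)) * (D *v (transpose D *v \<beta>)) $ i"
      unfolding \<alpha>_def Dv by simp
    then show ?thesis
      using arg_cong[OF \<beta>, of "\<lambda>v. v $ i"] by (simp add: gD)
  qed
  show ?thesis
  proof (rule that[OF g(1) fit])
    fix \<alpha>' :: "real^'d" and g' :: "real^'d \<Rightarrow> real"
    assume g': "g' \<in> H"
    define a where "a = \<alpha>' - \<alpha>"
    define h where "h = (\<lambda>x. g' x - g x)"
    have h: "h \<in> H" unfolding h_def by (rule diff_mem[OF g' g(1)])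
    define d where "d i = D $ i \<bullet> a + h (D $ i)" for i
    have res: "y $ i - D $ i \<bullet> \<alpha> - g (D $ i) = \<beta> $ i" for i using fit[of i] by simp
    have res': "y $ i - D $ i \<bullet> \<alpha>' - g' (D $ i) = \<beta> $ i - d i" for i
      using fit[of i] by (simp add: d_def a_def h_def inner_diff_right)
    have "\<mu> * (\<alpha> \<bullet> a) = (\<Sum>i\<in>UNIV. \<beta> $ i * (D $ i \<bullet> a)) / ?n"
    proof -
      have "(transpose D *v \<beta>) \<bullet> a = \<beta> \<bullet> (D *v a)"
        by (simp add: inner_matrix_vector_transpose)
      then have "\<mu> * (\<alpha> \<bullet> a) = (\<beta> \<bullet> (D *v a)) / ?n"
        using \<open>0 < \<mu>\<close> by (simp add: \<alpha>_def)
      then show ?thesis by (simp add: inner_vec_def[of \<beta>] Dv)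
    qed
    moreover have "lam * ip g h = (\<Sum>i\<in>UNIV. \<beta> $ i * h (D $ i)) / ?n"
      using g(2)[OF h] \<open>0 < lam\<close> by (simp add: sum_distrib_left sum_divide_distrib field_simps)
    ultimately have cross: "\<mu> * (\<alpha> \<bullet> a) + lam * ip g h = (\<Sum>i\<in>UNIV. \<beta> $ i * d i) / ?n"
      by (simp add: d_def distrib_left sum.distrib add_divide_distrib)
    have "objective D ip \<mu> lam y (\<alpha>', g')
        = (\<Sum>i\<in>UNIV. (\<beta> $ i - d i)\<^sup>2) / ?n + \<mu> * (norm (\<alpha> + a))\<^sup>2
          + lam * (rkhs_norm ip (\<lambda>x. g x + h x))\<^sup>2"
      by (simp add: objective_def res' a_def h_def)
    also have "(\<Sum>i\<in>UNIV. (\<beta> $ i - d i)\<^sup>2)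
        = (\<Sum>i\<in>UNIV. (\<beta> $ i)\<^sup>2) - 2 * (\<Sum>i\<in>UNIV. \<beta> $ i * d i) + (\<Sum>i\<in>UNIV. (d i)\<^sup>2)"
      by (simp add: power2_diff sum.distrib sum_subtractf sum_distrib_left mult.assoc)
    also have "(norm (\<alpha> + a))\<^sup>2 = (norm \<alpha>)\<^sup>2 + 2 * (\<alpha> \<bullet> a) + (norm a)\<^sup>2"
      by (simp add: power2_norm_eq_inner inner_add_left inner_add_right inner_commute)
    also have "(rkhs_norm ip (\<lambda>x. g x + h x))\<^sup>2 = ip g g + 2 * ip g h + ip h h"
      by (rule rkhs_norm_square_add[OF g(1) h])
    finally have "objective D ip \<mu> lam y (\<alpha>', g')
        = (\<Sum>i\<in>UNIV. (\<beta> $ i)\<^sup>2) / ?n + \<mu> * (norm \<alpha>)\<^sup>2 + lam * ip g g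
          + (\<Sum>i\<in>UNIV. (d i)\<^sup>2) / ?n + \<mu> * (norm a)\<^sup>2 + lam * ip h h
          + 2 * (\<mu> * (\<alpha> \<bullet> a) + lam * ip g h - (\<Sum>i\<in>UNIV. \<beta> $ i * d i) / ?n)"
      by (simp add: add_divide_distrib diff_divide_distrib algebra_simps)
    moreover have "objective D ip \<mu> lam y (\<alpha>, g)
        = (\<Sum>i\<in>UNIV. (\<beta> $ i)\<^sup>2) / ?n + \<mu> * (norm \<alpha>)\<^sup>2 + lam * ip g g"
      by (simp add: objective_def res rkhs_norm_square[OF g(1)])
    ultimately show "objective D ip \<mu> lam y (\<alpha>', g') = objective D ip \<mu> lam y (\<alpha>, g)
        + (\<Sum>i\<in>UNIV. (D $ i \<bullet> (\<alpha>' - \<alpha>) + (g' (D $ i) - g (D $ i)))\<^sup>2) / ?n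
        + \<mu> * (norm (\<alpha>' - \<alpha>))\<^sup>2 + lam * ip (\<lambda>x. g' x - g x) (\<lambda>x. g' x - g x)"
      using cross by (simp add: d_def a_def h_def)
  qed
qed

text \<open>
  The first part transfers the explicit minimiser to \<open>arg_min\<close>, which needs uniqueness. The second
  part is the lower bound obtained by dropping the two penalties from the minimal value; applied to
  noiseless data it controls the bias.
\<close>

lemma ridge_estimator_at_design:
  fixes D :: "real^'d^'n" and \<beta> y :: "real^'n"
  assumes rk: "rkhs X K H ip" and D: "\<And>i. D $ i \<in> X" and "0 < \<mu>" "0 < lam"
    and \<beta>: "\<beta> + (1 / (real CARD('n) * \<mu>)) *\<^sub>R (D *v (transpose D *v \<beta>))
               + (1 / lam) *\<^sub>R (kernel_matrix K D *v \<beta>) = y"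
  shows "ridge_estimator D H ip \<mu> lam y (D $ i) = y $ i - \<beta> $ i"
    and "\<And>\<alpha>' g'. g' \<in> H \<Longrightarrow>
      (\<Sum>i\<in>UNIV. (\<beta> $ i)\<^sup>2) / real CARD('n) \<le> objective D ip \<mu> lam y (\<alpha>', g')"
proof -
  interpret rkhs X K H ip by (rule rk)
  obtain \<alpha> g where g: "g \<in> H" and fit: "\<And>i. D $ i \<bullet> \<alpha> + g (D $ i) = y $ i - \<beta> $ i"
    and expand: "\<And>\<alpha>' g'. g' \<in> H \<Longrightarrow> objective D ip \<mu> lam y (\<alpha>', g') = objective D ip \<mu> lam y (\<alpha>, g)
        + (\<Sum>i\<in>UNIV. (D $ i \<bullet> (\<alpha>' - \<alpha>) + (g' (D $ i) - g (D $ i)))\<^sup>2) / real CARD('n)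
        + \<mu> * (norm (\<alpha>' - \<alpha>))\<^sup>2 + lam * ip (\<lambda>x. g' x - g x) (\<lambda>x. g' x - g x)"
    by (rule ridge_objective_expansion[OF rk D \<open>0 < \<mu>\<close> \<open>0 < lam\<close> \<beta>]) (rule that)
  have gap: "objective D ip \<mu> lam y (\<alpha>, g) + \<mu> * (norm (\<alpha>' - \<alpha>))\<^sup>2
        + lam * ip (\<lambda>x. g' x - g x) (\<lambda>x. g' x - g x) \<le> objective D ip \<mu> lam y (\<alpha>', g')"
    if "g' \<in> H" for \<alpha>' g'
    unfolding expand[OF that] by (simp add: sum_nonneg)
  have le: "objective D ip \<mu> lam y (\<alpha>, g) \<le> objective D ip \<mu> lam y (\<alpha>', g')" if "g' \<in> H" for \<alpha>' g'
  proof -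
    have "0 \<le> \<mu> * (norm (\<alpha>' - \<alpha>))\<^sup>2" "0 \<le> lam * ip (\<lambda>x. g' x - g x) (\<lambda>x. g' x - g x)"
      using \<open>0 < \<mu>\<close> \<open>0 < lam\<close> ip_nonneg[OF diff_mem[OF that g]] by auto
    then show ?thesis using gap[OF that, of \<alpha>'] by linarith
  qed
  have "arg_min (objective D ip \<mu> lam y) (\<lambda>(\<alpha>, g). g \<in> H) = (\<alpha>, g)"
  proof (rule arg_minI[of _ "(\<alpha>, g)"])
    fix m assume m: "case m of (\<alpha>, g) \<Rightarrow> g \<in> H"
      "\<forall>m'. (case m' of (\<alpha>, g) \<Rightarrow> g \<in> H) \<longrightarrow> \<not> objective D ip \<mu> lam y m' < objective D ip \<mu> lam y m"
    obtain \<alpha>' g' where m_eq: "m = (\<alpha>', g')" by (cases m)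
    have g': "g' \<in> H" using m(1) m_eq by simp
    have "objective D ip \<mu> lam y (\<alpha>', g') \<le> objective D ip \<mu> lam y (\<alpha>, g)"
      using m(2)[rule_format, of "(\<alpha>, g)"] g by (simp add: m_eq not_less)
    then have "\<mu> * (norm (\<alpha>' - \<alpha>))\<^sup>2 + lam * ip (\<lambda>x. g' x - g x) (\<lambda>x. g' x - g x) \<le> 0"
      using gap[OF g', of \<alpha>'] by linarith
    moreover have hm: "(\<lambda>x. g' x - g x) \<in> H" by (rule diff_mem[OF g' g])
    ultimately have "\<mu> * (norm (\<alpha>' - \<alpha>))\<^sup>2 = 0" "lam * ip (\<lambda>x. g' x - g x) (\<lambda>x. g' x - g x) = 0"
      using \<open>0 < \<mu>\<close> \<open>0 < lam\<close> ip_nonneg[OF hm]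
      by (smt (verit) mult_nonneg_nonneg zero_le_power2)+
    then have "\<alpha>' = \<alpha>" "(\<lambda>x. g' x - g x) = (\<lambda>x. 0)"
      using \<open>0 < \<mu>\<close> \<open>0 < lam\<close> ip_definite[OF hm] by auto
    then show "m = (\<alpha>, g)" by (auto simp: m_eq fun_eq_iff)
  qed (use g le in \<open>auto simp: not_less\<close>)
  then show "ridge_estimator D H ip \<mu> lam y (D $ i) = y $ i - \<beta> $ i"
    by (simp add: ridge_estimator_def fit)
  have "(\<Sum>i\<in>UNIV. (\<beta> $ i)\<^sup>2) / real CARD('n) \<le> objective D ip \<mu> lam y (\<alpha>, g)"
  proof -
    have "y $ i - D $ i \<bullet> \<alpha> - g (D $ i) = \<beta> $ i" for i using fit[of i] by simp
    then show ?thesis using \<open>0 < \<mu>\<close> \<open>0 < lam\<close> by (simp add: objective_def)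
  qed
  then show "(\<Sum>i\<in>UNIV. (\<beta> $ i)\<^sup>2) / real CARD('n) \<le> objective D ip \<mu> lam y (\<alpha>', g')"
    if "g' \<in> H" for \<alpha>' g'
    using le[OF that, of \<alpha>'] by linarith
qed

lemma ridge_estimator_residual:
  fixes D :: "real^'d^'n" and y :: "real^'n"
  assumes rk: "rkhs X K H ip" and D: "\<And>i. D $ i \<in> X" and "0 < \<mu>" "0 < lam"
    and G: "psd_matrix (kernel_matrix K D)"
  defines "R \<equiv> residual_mat D (kernel_matrix K D) \<mu> lam"
  shows "ridge_estimator D H ip \<mu> lam y (D $ i) = y $ i - (R *v y) $ i"
    and "\<And>\<alpha> g. g \<in> H \<Longrightarrow>
      (\<Sum>i\<in>UNIV. ((R *v y) $ i)\<^sup>2) / real CARD('n) \<le> objective D ip \<mu> lam y (\<alpha>, g)"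
proof -
  have "ridge_precision D (kernel_matrix K D) \<mu> lam *v (R *v y) = y"
    using residual_mat_inverse(2)[OF G \<open>0 < \<mu>\<close> \<open>0 < lam\<close>, of D]
    by (simp add: R_def matrix_vector_mul_assoc)
  moreover define \<beta> where "\<beta> = R *v y"
  ultimately have "\<beta> + (1 / (real CARD('n) * \<mu>)) *\<^sub>R (D *v (transpose D *v \<beta>))
      + (1 / lam) *\<^sub>R (kernel_matrix K D *v \<beta>) = y"
    by (simp add: ridge_precision_def matrix_vector_mult_add_rdistrib
        matrix_vector_mul_assoc[symmetric] scaleR_matrix_vector_assoc[symmetric])
  note est = ridge_estimator_at_design[OF rk D \<open>0 < \<mu>\<close> \<open>0 < lam\<close> this]
  show "ridge_estimator D H ip \<mu> lam y (D $ i) = y $ i - (R *v y) $ i"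
    using est(1) by (simp add: \<beta>_def)
  show "(\<Sum>i\<in>UNIV. ((R *v y) $ i)\<^sup>2) / real CARD('n) \<le> objective D ip \<mu> lam y (\<alpha>, g)"
    if "g \<in> H" for \<alpha> g
    using est(2)[OF that] by (simp add: \<beta>_def)
qed

section \<open>Bias and variance\<close>

text \<open>
  Independent centred variables are pairwise uncorrelated, so the cross terms in the expanded square
  have expectation 0.
\<close>

lemma (in prob_space) expectation_square_affine_noise:
  fixes \<epsilon> :: "'i::finite \<Rightarrow> 'a \<Rightarrow> real"
  assumes ind: "indep_vars (\<lambda>_. borel) \<epsilon> UNIV"
    and int2: "\<And>i. integrable M (\<lambda>w. (\<epsilon> i w)\<^sup>2)"
    and mean: "\<And>i. expectation (\<epsilon> i) = 0"
    and var: "\<And>i. expectation (\<lambda>w. (\<epsilon> i w)\<^sup>2) = v"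
  shows "expectation (\<lambda>w. (a + (\<Sum>j\<in>UNIV. c j * \<epsilon> j w))\<^sup>2) = a\<^sup>2 + v * (\<Sum>j\<in>UNIV. (c j)\<^sup>2)"
proof -
  have meas: "\<epsilon> i \<in> borel_measurable M" for i
    using ind by (auto simp: indep_vars_def)
  have int: "integrable M (\<epsilon> i)" for i
    by (rule square_integrable_imp_integrable[OF meas int2])
  have prod: "integrable M (\<lambda>w. \<epsilon> i w * \<epsilon> j w)
      \<and> expectation (\<lambda>w. \<epsilon> i w * \<epsilon> j w) = (if i = j then v else 0)" for i j
  proof (cases "i = j")
    case True
    then show ?thesis using int2 var by (simp add: power2_eq_square)
  next
    case False
    have "indep_vars (\<lambda>_. borel) \<epsilon> {i, j}" by (rule indep_vars_subset[OF ind]) auto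
    then show ?thesis
      using indep_vars_integrable[of "{i, j}" \<epsilon>] indep_vars_lebesgue_integral[of "{i, j}" \<epsilon>] int mean False
      by simp
  qed
  have "(\<lambda>w. (a + (\<Sum>j\<in>UNIV. c j * \<epsilon> j w))\<^sup>2)
      = (\<lambda>w. a\<^sup>2 + 2 * a * (\<Sum>j\<in>UNIV. c j * \<epsilon> j w)
          + (\<Sum>i\<in>UNIV. \<Sum>j\<in>UNIV. c i * c j * (\<epsilon> i w * \<epsilon> j w)))"
    by (simp add: fun_eq_iff power2_sum power2_eq_square[of "sum _ _"] sum_product mult_ac)
  then have "expectation (\<lambda>w. (a + (\<Sum>j\<in>UNIV. c j * \<epsilon> j w))\<^sup>2)
      = a\<^sup>2 + 2 * a * (\<Sum>j\<in>UNIV. c j * expectation (\<epsilon> j))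
          + (\<Sum>i\<in>UNIV. \<Sum>j\<in>UNIV. c i * c j * expectation (\<lambda>w. \<epsilon> i w * \<epsilon> j w))"
    using int prod by (simp add: prob_space)
  also have "\<dots> = a\<^sup>2 + v * (\<Sum>j\<in>UNIV. (c j)\<^sup>2)"
    by (simp add: mean prod if_distrib sum_distrib_left power2_eq_square mult_ac cong: if_cong)
  finally show ?thesis .
qed

theorem theorem4:
  fixes X :: "(real^'d) set"
    and D :: "real^'d^'n"
    and K :: "real^'d \<Rightarrow> real^'d \<Rightarrow> real"
    and H :: "(real^'d \<Rightarrow> real) set"
    and ip :: "(real^'d \<Rightarrow> real) \<Rightarrow> (real^'d \<Rightarrow> real) \<Rightarrow> real"
    and fstar :: "real^'d \<Rightarrow> real"
    and M :: "'w measure"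
    and \<epsilon> :: "'n \<Rightarrow> 'w \<Rightarrow> real"
    and Y :: "'w \<Rightarrow> real^'n"
    and \<sigma> \<mu> lam :: real
    and \<nu> \<tau> :: "nat \<Rightarrow> real"
  assumes "\<And>i. D $ i \<in> X"
    and "\<And>x y. x \<in> X \<Longrightarrow> y \<in> X \<Longrightarrow> K x y = K y x"
    and "psd_kernel_on X K"
    and "rkhs X K H ip"
    and "prob_space M"
    and "prob_space.indep_vars M (\<lambda>_. borel) \<epsilon> UNIV"
    and "\<And>i. integrable M (\<lambda>w. (\<epsilon> i w)\<^sup>2)"
    and "\<And>i. prob_space.expectation M (\<epsilon> i) = 0"
    and "\<And>i. prob_space.expectation M (\<lambda>w. (\<epsilon> i w)\<^sup>2) = \<sigma>\<^sup>2"
    and "\<And>w i. Y w $ i = fstar (D $ i) + \<epsilon> i w"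
    and "\<mu> > 0" and "lam > 0"
    and "eigenvalue_seq (emp_cov D) \<tau>"
    and "eigenvalue_seq (Q_mat D \<mu> ** kernel_matrix K D ** Q_mat D \<mu>) \<nu>"
  shows "risk M D (\<lambda>w x. ridge_estimator D H ip \<mu> lam (Y w) x - fstar x)
    \<le> (INF (\<alpha>, f) \<in> UNIV \<times> H.
          risk M D (\<lambda>_ x. \<alpha> \<bullet> x + f x - fstar x)
            + \<mu> * (norm \<alpha>)\<^sup>2 + lam * (rkhs_norm ip f)\<^sup>2)
      + 2 * \<sigma>\<^sup>2 / real CARD('n) *
          ((\<Sum>i=1..CARD('d). (\<tau> i / (\<tau> i + \<mu>))\<^sup>2)
            + (\<Sum>i=1..CARD('n). (\<nu> i / (\<nu> i + lam))\<^sup>2))"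
proof -
  interpret prob_space M by fact
  define G where "G = kernel_matrix K D"
  define R where "R = residual_mat D G \<mu> lam"
  define f where "f = (\<chi> i. fstar (D $ i))"
  let ?n = "real CARD('n)"
  let ?S = "\<lambda>i j. (mat 1 - R) $ i $ j"
  let ?V = "(\<Sum>i=1..CARD('d). (\<tau> i / (\<tau> i + \<mu>))\<^sup>2) + (\<Sum>i=1..CARD('n). (\<nu> i / (\<nu> i + lam))\<^sup>2)"
  have G: "psd_matrix G" unfolding G_def by (rule psd_matrix_kernel_matrix[OF assms(1-3)])
  note est = ridge_estimator_residual[OF assms(4,1) \<open>\<mu> > 0\<close> \<open>lam > 0\<close>, folded G_def, folded R_def, OF G]
  have error: "ridge_estimator D H ip \<mu> lam (Y w) (D $ i) - fstar (D $ i)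
      = - (R *v f) $ i + (\<Sum>j\<in>UNIV. ?S i j * \<epsilon> j w)" for w i
  proof -
    have Y: "Y w = f + (\<chi> i. \<epsilon> i w)" by (simp add: vec_eq_iff f_def assms(10))
    have "ridge_estimator D H ip \<mu> lam (Y w) (D $ i) = ((mat 1 - R) *v Y w) $ i"
      by (simp add: est(1) matrix_vector_mult_diff_rdistrib)
    also have "\<dots> = f $ i - (R *v f) $ i + ((mat 1 - R) *v (\<chi> i. \<epsilon> i w)) $ i"
      by (simp add: Y matrix_vector_right_distrib matrix_vector_mult_diff_rdistrib)
    finally show ?thesis by (simp add: f_def matrix_vector_mult_def)
  qed
  have "risk M D (\<lambda>w x. ridge_estimator D H ip \<mu> lam (Y w) x - fstar x)
      = (\<Sum>i\<in>UNIV. ((R *v f) $ i)\<^sup>2 + \<sigma>\<^sup>2 * (\<Sum>j\<in>UNIV. (?S i j)\<^sup>2)) / ?n"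
    unfolding risk_def error
      expectation_square_affine_noise[OF assms(6,7,8,9)] power2_minus ..
  also have "\<dots> = (\<Sum>i\<in>UNIV. ((R *v f) $ i)\<^sup>2) / ?n + \<sigma>\<^sup>2 / ?n * (\<Sum>i\<in>UNIV. \<Sum>j\<in>UNIV. (?S i j)\<^sup>2)"
    by (simp only: sum.distrib add_divide_distrib sum_distrib_left[symmetric] times_divide_eq_left)
  also have "\<dots> \<le> (\<Sum>i\<in>UNIV. ((R *v f) $ i)\<^sup>2) / ?n + \<sigma>\<^sup>2 / ?n * (2 * ?V)"
    using smoother_sum_squares_le[OF G \<open>\<mu> > 0\<close> \<open>lam > 0\<close> assms(13), of \<nu>] assms(14)
    by (intro add_left_mono mult_left_mono) (auto simp: R_def G_def)
  also have "\<sigma>\<^sup>2 / ?n * (2 * ?V) = 2 * \<sigma>\<^sup>2 / ?n * ?V"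
    by (simp only: times_divide_eq_left mult_ac)
  finally have risk: "risk M D (\<lambda>w x. ridge_estimator D H ip \<mu> lam (Y w) x - fstar x)
      \<le> (\<Sum>i\<in>UNIV. ((R *v f) $ i)\<^sup>2) / ?n + 2 * \<sigma>\<^sup>2 / ?n * ?V" .
  \<comment> \<open>The bias is bounded by the objective at the noiseless data \<open>f\<close>, for each competitor separately.\<close>
  have "(\<Sum>i\<in>UNIV. ((R *v f) $ i)\<^sup>2) / ?n \<le> (INF (\<alpha>, f) \<in> UNIV \<times> H.
          risk M D (\<lambda>_ x. \<alpha> \<bullet> x + f x - fstar x) + \<mu> * (norm \<alpha>)\<^sup>2 + lam * (rkhs_norm ip f)\<^sup>2)"
  proof (rule cINF_greatest, goal_cases)
    case 1
    show ?case using rkhs.zero_mem[OF assms(4)] by auto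
  next
    case (2 p)
    obtain \<alpha> g where p: "p = (\<alpha>, g)" "g \<in> H" using 2 by auto
    have "(f $ i - D $ i \<bullet> \<alpha> - g (D $ i))\<^sup>2 = (\<alpha> \<bullet> D $ i + g (D $ i) - fstar (D $ i))\<^sup>2" for i
      by (simp add: f_def inner_commute power2_eq_iff)
    then have "objective D ip \<mu> lam f (\<alpha>, g)
        = risk M D (\<lambda>_ x. \<alpha> \<bullet> x + g x - fstar x) + \<mu> * (norm \<alpha>)\<^sup>2 + lam * (rkhs_norm ip g)\<^sup>2"
      by (simp add: objective_def risk_def prob_space)
    then show ?case using est(2)[OF p(2), of f \<alpha>] by (simp add: p(1))
  qed
  then show ?thesis using risk by linarith
qed

end
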